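(* Let $D>1$ be a square-free integer with $-D\equiv 2$ or $3 \pmod 4$, and suppose the form class group $C(-4D)$ (the class group of $\mathbb{Q}[\sqrt{-D}]$) is a free $\mathbb{Z}_2$-module, i.e. $C(-4D)\cong(\mathbb{Z}/2\mathbb{Z})^n$ for some $n\ge 0$. Then $G_D(\mathbb{Q})=U\times F$, where $U=\{\pm1\}$ and $F$ is a free abelian group. Moreover, let $c=p_1^{n_1}\cdots p_k^{n_k}$ with $p_1,\dots,p_k$ distinct primes and $n_i\ge 1$. If $\left(\frac{-D}{p_i}\right)=1$ for all $1\le i\le k$, then the number of normalized solutions of the form $(a,b,c)$ to $x^2+Dy^2=z^2$ is $2^{k-1}$. Otherwise, there are no normalized solutions of the form $(a,b,c)$.
   Context: $G_D(\mathbb{Q}):=\{a+b\sqrt{-D}\in\mathbb{Q}[\sqrt{-D}]: a,b\in\mathbb{Q},\ a^2+Db^2=1\}$, a group under multiplication of complex numbers. A normalized solution of $x^2+Dy^2=z^2$ is a triple $(a,b,c)$ of natural numbers with $a^2+Db^2=c^2$ and $\gcd(a,b,c)=1$. $C(-4D)$ denotes the set of $\mathrm{SL}_2(\mathbb{Z})$-equivalence classes of primitive positive-definite binary quadratic forms $ax^2+bxy+cy^2$ of discriminant $b^2-4ac=-4D$, a group under Dirichlet composition. $\left(\frac{\cdot}{p}\right)$ is the Legendre symbol (for odd primes $p$). *)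

theory Defs
  imports Complex_Main "HOL-Number_Theory.Number_Theory" "HOL-Computational_Algebra.Squarefree"
begin

type_synonym qform = "int \<times> int \<times> int"

definition qf_eval :: "qform \<Rightarrow> int \<Rightarrow> int \<Rightarrow> int" where
  "qf_eval f x y = (case f of (a,b,c) \<Rightarrow> a*x^2 + b*x*y + c*y^2)"

definition qf_disc :: "qform \<Rightarrow> int" where
  "qf_disc f = (case f of (a,b,c) \<Rightarrow> b^2 - 4*a*c)"

definition qf_primitive :: "qform \<Rightarrow> bool" where
  "qf_primitive f = (case f of (a,b,c) \<Rightarrow> gcd (gcd a b) c = 1)"

definition qf_posdef :: "qform \<Rightarrow> bool" where
  "qf_posdef f = (case f of (a,b,c) \<Rightarrow> a > 0 \<and> qf_disc f < 0)"

definition qf_equiv :: "qform \<Rightarrow> qform \<Rightarrow> bool" where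
  "qf_equiv f g = (\<exists>p q r s. p*s - q*r = 1 \<and>
      (\<forall>x y. qf_eval g x y = qf_eval f (p*x + q*y) (r*x + s*y)))"

definition qf_in_C :: "int \<Rightarrow> qform \<Rightarrow> bool" where
  "qf_in_C d f = (qf_primitive f \<and> qf_posdef f \<and> qf_disc f = d)"

text \<open>Dirichlet composition via united forms: the class of h is the composite of
  the classes of f and g iff f ~ (a1,B,a2 C), g ~ (a2,B,a1 C), h ~ (a1 a2,B,C)
  with gcd(a1,a2,B) = 1.\<close>
definition dirichlet_comp :: "qform \<Rightarrow> qform \<Rightarrow> qform \<Rightarrow> bool" where
  "dirichlet_comp f g h = (\<exists>a1 a2 B C. a1 > 0 \<and> a2 > 0 \<and> gcd (gcd a1 a2) B = 1 \<and>
      qf_equiv f (a1, B, a2*C) \<and> qf_equiv g (a2, B, a1*C) \<and> qf_equiv h (a1*a2, B, C))"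

text \<open>The (finite) form class group C(-4D) is isomorphic to (Z/2Z)^n for some n,
  i.e. has exponent dividing 2: the square of every class is the principal class
  (the class of x^2 + D y^2).\<close>
definition class_group_elem_2 :: "int \<Rightarrow> bool" where
  "class_group_elem_2 D = (\<forall>f h. qf_in_C (-4*D) f \<longrightarrow> dirichlet_comp f f h \<longrightarrow>
      qf_equiv h (1, 0, D))"

definition G_D :: "int \<Rightarrow> complex set" where
  "G_D D = {z. \<exists>a b :: rat. z = of_real (of_rat a) + of_real (of_rat b) * \<i> * of_real (sqrt (of_int D))
                  \<and> a^2 + of_int D * b^2 = 1}"

definition free_abelian_mult :: "complex set \<Rightarrow> bool" where
  "free_abelian_mult F = (\<exists>B \<subseteq> F. \<forall>x \<in> F. \<exists>!e :: complex \<Rightarrow> int.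
      finite {b. e b \<noteq> 0} \<and> {b. e b \<noteq> 0} \<subseteq> B \<and> x = (\<Prod>b \<in> {b. e b \<noteq> 0}. b powi e b))"

definition mult_subgroup :: "complex set \<Rightarrow> complex set \<Rightarrow> bool" where
  "mult_subgroup F G = (F \<subseteq> G \<and> 1 \<in> F \<and> (\<forall>x\<in>F. \<forall>y\<in>F. x*y \<in> F) \<and> (\<forall>x\<in>F. inverse x \<in> F))"

definition normalized_solutions :: "int \<Rightarrow> nat \<Rightarrow> (nat \<times> nat) set" where
  "normalized_solutions D c = {(a,b). int a ^ 2 + D * int b ^ 2 = int c ^ 2 \<and> gcd (gcd a b) c = 1}"

end

(* For a split prime p there is a form (p, 2b, pC) of discriminant -4D, whose square in the class
   group is represented by (p^2, 2b, C). As all squares are principal, p^2 = s^2 + D r^2 properly,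
   and u_p = (s + r sqrt(-D)) / p lies in G_D(Q). Multiplying a primitive solution a + b sqrt(-D)
   with denominator c by u_p or its conjugate removes a factor p from c, so -1 and the u_p
   generate G_D(Q). No power of u_p is p-integral while u_q is for every other q; hence the u_p
   are independent and the product of the u_p^(e_p) has exact denominator the product of the
   p^|e_p|. The solutions with a given c thus correspond to a sign and a choice of sign for each
   e_p, and forgetting the signs of a and b divides their number by 4. *)

theory Submission
  imports Defs
begin

text \<open>In terms of ideals, s + r sqrt(-D) generates the square of one of the two prime ideals
  above p, so u_p generates the quotient of that ideal by its conjugate, and exponents of u_p are
  valuations. The proof works without ideals: everything is computed on pairs of integers, "square
  of a single prime ideal" becomes the condition that p does not divide s, and valuations become
  integrality after clearing denominators prime to p. Each hypothesis on D removes a disturbance.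
  Square-freeness keeps the divisors of D out of reduced denominators, the congruence modulo 4 keeps
  out 2, and D > 1 leaves only 1 and -1 as elements of denominator 1. The delicate point is that the
  obvious denominator of a product of powers is the exact one, since a prime could a priori cancel
  through the numerators belonging to other primes. It is settled one prime q at a time: all other
  factors are units at q.\<close>

section \<open>Square roots of -D modulo p^2 and proper representations of p^2\<close>

lemma odd_prime_not_dvd_two:
  fixes p :: int
  assumes "prime p" "odd p"
  shows "\<not> p dvd 2"
proof
  assume "p dvd 2"
  then have "p \<le> 2" by (rule zdvd_imp_le) simp
  then have "p = 2" using prime_ge_2_int[OF assms(1)] by simp
  then show False using assms(2) by simp
qed

text \<open>The factor not divisible by p is coprime to p^2, so the whole square passes to the other
  one. In the descent the two factors belong to the two conjugate multipliers.\<close>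

lemma prime_square_dvd_mult:
  fixes p x y :: int
  assumes "prime p" "p^2 dvd x * y" "\<not> (p dvd x \<and> p dvd y)"
  shows "p^2 dvd x \<or> p^2 dvd y"
proof (cases "p dvd x")
  case True
  then have "coprime (p^2) y" using assms by (simp add: prime_imp_coprime)
  then show ?thesis using assms(2) coprime_dvd_mult_left_iff by blast
next
  case False
  then have "coprime (p^2) x" using assms by (simp add: prime_imp_coprime)
  then show ?thesis using assms(2) coprime_dvd_mult_right_iff by blast
qed

text \<open>One step of Hensel lifting, possible because the derivative 2 b is invertible modulo
  p.\<close>

lemma square_root_lift:
  fixes p b m :: int
  assumes "prime p" "\<not> p dvd 2 * b" "p dvd b^2 + m"
  shows "\<exists>b'. p^2 dvd b'^2 + m \<and> \<not> p dvd 2 * b'"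
proof -
  obtain k where k: "b^2 + m = p * k" using assms(3) by auto
  have "coprime (2 * b) p" using prime_imp_coprime[OF assms(1,2)] by (simp only: coprime_commute)
  \<comment> \<open>The lifted root is b + p t, where t solves 2 b t = -k modulo p; this needs the
    inverse i of 2 b.\<close>
  then obtain i where "[2 * b * i = 1] (mod p)" using cong_solve_coprime_int by blast
  then have "[2 * b * i * (-k) = 1 * (-k)] (mod p)" by (rule cong_scalar_right)
  then have "p dvd 2 * b * i * (-k) - 1 * (-k)" by (simp only: cong_iff_dvd_diff)
  then obtain l where l: "2 * b * i * (-k) - 1 * (-k) = p * l" by blast
  define t where "t = i * (-k)"
  have l': "k = p * l - 2 * b * t" using l by (simp add: t_def algebra_simps)
  have "(b + p * t)^2 + m = p * k + 2 * b * t * p + p^2 * t^2" using k by (simp add: power2_eq_square algebra_simps)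
  also have "\<dots> = p^2 * (l + t^2)" unfolding l' by (simp add: power2_eq_square algebra_simps)
  finally have "p^2 dvd (b + p * t)^2 + m" by simp
  moreover have "\<not> p dvd 2 * (b + p * t)"
  proof
    assume "p dvd 2 * (b + p * t)"
    then have "p dvd 2 * (b + p * t) - p * (2 * t)" by (metis dvd_diff dvd_triv_left)
    then show False using assms(2) by (simp add: algebra_simps)
  qed
  ultimately show ?thesis by blast
qed

lemma qf_equiv_refl: "qf_equiv f f"
  unfolding qf_equiv_def by (rule exI[of _ 1], rule exI[of _ 0], rule exI[of _ 0], rule exI[of _ 1]) simp

lemma primitive_rep_of_principal:
  assumes "qf_equiv (n, B, C) (1, 0, D)"
  obtains s r where "s^2 + D * r^2 = n" "coprime s r"
proof -
  obtain \<alpha> \<beta> \<gamma> \<delta> where det: "\<alpha> * \<delta> - \<beta> * \<gamma> = 1"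
    and ev: "\<And>x y. qf_eval (1, 0, D) x y = qf_eval (n, B, C) (\<alpha> * x + \<beta> * y) (\<gamma> * x + \<delta> * y)"
    using assms unfolding qf_equiv_def by blast
  \<comment> \<open>The vector (\<delta>, -\<gamma>) is the first column of the inverse matrix, so
    the substitution sends it to (1, 0), where the form takes the value n.\<close>
  have "qf_eval (1, 0, D) \<delta> (-\<gamma>) = qf_eval (n, B, C) 1 0"
    using ev[of \<delta> "-\<gamma>"] det by (simp add: algebra_simps)
  then have "\<delta>^2 + D * \<gamma>^2 = n" by (simp add: qf_eval_def)
  moreover have "coprime \<delta> \<gamma>"
  proof (rule coprimeI)
    fix d assume "d dvd \<delta>" "d dvd \<gamma>"
    then have "d dvd \<alpha> * \<delta> - \<beta> * \<gamma>" by simp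
    then show "is_unit d" using det by simp
  qed
  ultimately show ?thesis using that by blast
qed

text \<open>That p does not divide s excludes the trivial representation with r = 0 and s = p or s =
  -p; it comes from the coprimality of s and r.\<close>

lemma split_prime_square_rep:
  fixes D :: int and p :: nat
  assumes "D > 0" "class_group_elem_2 D" "prime p" "p \<noteq> 2" "Legendre (-D) (int p) = 1"
  shows "\<exists>s r. s^2 + D * r^2 = int p ^ 2 \<and> \<not> int p dvd s"
proof -
  have p: "prime (int p)" using assms by simp
  have pD: "\<not> int p dvd D" and "QuadRes (int p) (-D)"
    using assms(5) by (auto simp: Legendre_def cong_0_iff split: if_splits)
  then obtain b where "[b^2 = -D] (mod int p)" by (auto simp: QuadRes_def)
  then have b: "int p dvd b^2 + D" by (simp add: cong_iff_dvd_diff)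
  have "\<not> int p dvd b"
  proof
    assume "int p dvd b"
    then have "int p dvd b^2" by (simp add: power2_eq_square)
    then show False using b pD by (simp add: dvd_add_right_iff)
  qed
  moreover have p2: "\<not> int p dvd 2"
    using assms(3,4) by (metis int_dvd_int_iff of_nat_numeral primes_dvd_imp_eq two_is_prime_nat)
  ultimately have "\<not> int p dvd 2 * b" using p by (simp add: prime_dvd_mult_iff)
  \<comment> \<open>Divisibility by p^2, not just by p, puts a factor p into the last coefficient of
    \<open>?f\<close>; this is the shape that Dirichlet composition of \<open>?f\<close> with itself
    requires.\<close>
  from square_root_lift[OF p this b] obtain b' where b': "int p ^ 2 dvd b'^2 + D" "\<not> int p dvd 2 * b'"
    by blast
  then obtain C where C: "b'^2 + D = int p ^ 2 * C" by blast
  have cop: "coprime (int p) (2 * b')" using p b'(2) by (rule prime_imp_coprime)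
  let ?f = "(int p, 2 * b', int p * C)"
  have "gcd (gcd (int p) (2 * b')) (int p * C) = 1" using cop by (simp add: coprime_iff_gcd_eq_1)
  moreover have "qf_disc ?f = -4 * D" using C by (simp add: qf_disc_def power2_eq_square algebra_simps)
  ultimately have "qf_in_C (-4 * D) ?f"
    using assms(1,3) by (simp add: qf_in_C_def qf_primitive_def qf_posdef_def prime_gt_0_nat)
  moreover have "dirichlet_comp ?f ?f (int p ^ 2, 2 * b', C)"
    unfolding dirichlet_comp_def
    by (rule exI[of _ "int p"], rule exI[of _ "int p"], rule exI[of _ "2 * b'"], rule exI[of _ C])
      (use cop p in \<open>auto simp: qf_equiv_refl power2_eq_square prime_gt_0_int coprime_iff_gcd_eq_1 prime_gt_0_nat assms(3)\<close>)
  ultimately have "qf_equiv (int p ^ 2, 2 * b', C) (1, 0, D)"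
    using assms(2) unfolding class_group_elem_2_def by blast
  then obtain s r where sr: "s^2 + D * r^2 = int p ^ 2" "coprime s r"
    using primitive_rep_of_principal by blast
  have "\<not> int p dvd s"
  proof
    assume ps: "int p dvd s"
    then have "int p dvd D * r^2"
      using sr(1) by (metis dvd_add_right_iff dvd_power pos2 zero_less_numeral dvd_mult2 power2_eq_square)
    then have "int p dvd r" using p pD by (simp add: prime_dvd_mult_iff prime_dvd_power_iff)
    then show False using ps sr(2) p by (metis coprime_common_divisor not_prime_unit)
  qed
  then show ?thesis using sr(1) by blast
qed

section \<open>Prime divisors of c in a primitive solution, and the descent\<close>

text \<open>If p divides a and c, then p^2 divides D b^2, hence D, since p cannot divide b as well;
  this contradicts square-freeness. The other two claims reduce to this one.\<close>

lemma primitive_solution_not_dvd: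
  fixes a b c D p :: int
  assumes "squarefree D" "a^2 + D * b^2 = c^2" "gcd (gcd a b) c = 1" "prime p" "p dvd c"
  shows "\<not> p dvd a" "\<not> p dvd b" "\<not> p dvd D"
proof -
  have nab: "\<not> (p dvd a \<and> p dvd b)"
  proof
    assume "p dvd a \<and> p dvd b"
    then have "p dvd gcd (gcd a b) c" using assms(5) by simp
    then show False using assms(3,4) by (simp add: not_prime_unit)
  qed
  have c2: "p^2 dvd c^2" using assms(5) by simp
  show pa: "\<not> p dvd a"
  proof
    assume "p dvd a"
    then have "p^2 dvd a^2" by simp
    then have "p^2 dvd D * b^2" using assms(2) c2 by (metis dvd_add_right_iff)
    moreover have "coprime (p^2) (b^2)" using nab \<open>p dvd a\<close> assms(4) by (simp add: prime_imp_coprime)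
    ultimately have "p^2 dvd D" using coprime_dvd_mult_left_iff by blast
    then show False using assms(1,4) by (auto simp: squarefree_def)
  qed
  have "\<not> p dvd D * b^2"
  proof
    assume "p dvd D * b^2"
    moreover have "p dvd c^2" using assms(5) by (simp add: power2_eq_square)
    ultimately have "p dvd a^2" using assms(2) by (metis dvd_add_left_iff)
    then show False using pa assms(4) by (simp add: prime_dvd_power_iff)
  qed
  then show "\<not> p dvd b" "\<not> p dvd D" by (auto simp: power2_eq_square)
qed

text \<open>The prime 2 is impossible modulo 4. For the other primes b is invertible modulo p, and
  a/b is a square root of -D.\<close>

lemma primitive_solution_prime_split:
  fixes D a b :: int and c p :: nat
  assumes "squarefree D" "(-D) mod 4 = 2 \<or> (-D) mod 4 = 3"
    and sol: "a^2 + D * b^2 = int c ^ 2" "gcd (gcd a b) (int c) = 1" and p: "prime p" "p dvd c"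
  shows "p \<noteq> 2" "Legendre (-D) (int p) = 1"
proof -
  have pp: "prime (int p)" "int p dvd int c" using p by auto
  note nd = primitive_solution_not_dvd[OF assms(1) sol pp]
  show "p \<noteq> 2"
  proof
    assume [simp]: "p = 2"
    obtain i j where ij: "a = 2 * i + 1" "b = 2 * j + 1" using nd by (auto elim!: oddE)
    obtain k where k: "int c = 2 * k" using pp(2) by auto
    \<comment> \<open>Since a, b and D are odd here, a^2 + D b^2 is 2 modulo 4, whereas c^2 is 0
      modulo 4.\<close>
    have "D mod 4 = 1" using assms(2) nd(3) by simp presburger
    then obtain d where d: "D = 4 * d + 1" by (metis mult_div_mod_eq)
    have "a^2 + D * b^2 = 2 + 4 * (i^2 + i + 4 * d * j^2 + 4 * d * j + d + j^2 + j)"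
      unfolding ij d by (simp add: power2_eq_square algebra_simps)
    moreover have "int c ^ 2 = 4 * k^2" unfolding k by (simp add: power2_eq_square)
    ultimately show False using sol(1) by presburger
  qed
  have "coprime b (int p)" using prime_imp_coprime[OF pp(1) nd(2)] by (simp only: coprime_commute)
  then obtain i where i: "[b * i = 1] (mod int p)" using cong_solve_coprime_int by blast
  have "[a^2 = -D * b^2] (mod int p)"
    using sol(1) pp(2) by (simp add: cong_iff_dvd_diff power2_eq_square)
  then have "[a^2 * i^2 = -D * b^2 * i^2] (mod int p)" by (rule cong_scalar_right)
  moreover have "[-D * (b * i)^2 = -D * 1^2] (mod int p)" by (intro cong_scalar_left cong_pow i)
  ultimately have "[(a * i)^2 = -D] (mod int p)"
    by (simp add: power_mult_distrib algebra_simps) (metis cong_trans)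
  then have "QuadRes (int p) (-D)" by (auto simp: QuadRes_def)
  then show "Legendre (-D) (int p) = 1" using nd(3) by (simp add: Legendre_def cong_0_iff)
qed

text \<open>The idea of the descent: multiplying by the right one of the two conjugate elements of
  norm \<open>p\<^sup>2\<close> makes the product divisible by \<open>p\<^sup>2\<close>.\<close>

lemma primitive_solution_descent:
  fixes a b c D s r p :: int
  assumes "squarefree D" "a^2 + D * b^2 = (p * c)^2" "gcd (gcd a b) (p * c) = 1" "prime p" "odd p"
    and sr: "s^2 + D * r^2 = p^2" "\<not> p dvd s"
  shows "\<exists>a' b' \<sigma>. \<sigma> \<in> {1, -1} \<and> a'^2 + D * b'^2 = c^2 \<and> gcd (gcd a' b') c = 1 \<and>
           a = a' * s - D * b' * (\<sigma> * r) \<and> b = a' * (\<sigma> * r) + b' * s"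
proof -
  note nd = primitive_solution_not_dvd[OF assms(1-4) dvd_triv_left]
  have p0: "p \<noteq> 0" using assms(4) by auto
  \<comment> \<open>The factors are the coefficients of sqrt(-D) in the products of a + b sqrt(-D)
    with s + r sqrt(-D) and with its conjugate; the two norms make their product divisible by
    p^2.\<close>
  have "(b * s + a * r) * (b * s - a * r) = b^2 * (s^2 + D * r^2) - r^2 * (a^2 + D * b^2)"
    by (simp add: power2_eq_square algebra_simps)
  also have "\<dots> = p^2 * (b^2 - r^2 * c^2)" unfolding assms(2) sr(1) by (simp add: power2_eq_square algebra_simps)
  finally have "p^2 dvd (b * s + a * r) * (b * s - a * r)" by simp
  moreover have "\<not> (p dvd b * s + a * r \<and> p dvd b * s - a * r)"
  proof
    assume "p dvd b * s + a * r \<and> p dvd b * s - a * r"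
    then have "p dvd (b * s + a * r) + (b * s - a * r)" by (blast intro: dvd_add)
    then have "p dvd 2 * (b * s)" by (simp add: algebra_simps)
    moreover have "\<not> p dvd 2" using assms(4,5) by (rule odd_prime_not_dvd_two)
    ultimately show False using assms(4) nd(2) sr(2) by (simp add: prime_dvd_mult_iff)
  qed
  ultimately have "p^2 dvd b * s + a * r \<or> p^2 dvd b * s - a * r"
    using prime_square_dvd_mult assms(4) by blast
  then obtain \<sigma> where \<sigma>: "\<sigma> \<in> {1, -1}" "p^2 dvd b * s - \<sigma> * a * r"
    by (metis (no_types, opaque_lifting) diff_minus_eq_add insertI1 insertI2 mult_1 mult_minus1 mult_minus_left)
  have \<sigma>2: "\<sigma> * \<sigma> = 1" "\<sigma>^2 = 1" using \<sigma>(1) by auto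
  obtain b' where b': "b * s - \<sigma> * a * r = p^2 * b'" using \<sigma>(2) by blast
  \<comment> \<open>\<open>X\<close> and b s - \<sigma> a r are the coordinates of (a + b sqrt(-D))
    (s - \<sigma> r sqrt(-D)). By multiplicativity of the norm, p^2 then divides \<open>X\<close>
    too.\<close>
  define X where "X = a * s + \<sigma> * D * b * r"
  have "X^2 + D * (b * s - \<sigma> * a * r)^2 = (a^2 + D * b^2 * \<sigma>^2) * s^2 + D * (a^2 * \<sigma>^2 + D * b^2 * \<sigma>^2) * r^2 + D * b^2 * s^2 * (1 - \<sigma>^2)"
    by (simp add: X_def power2_eq_square algebra_simps)
  also have "\<dots> = (a^2 + D * b^2) * (s^2 + D * r^2)" by (simp add: \<sigma>2 algebra_simps)
  also have "\<dots> = p^4 * c^2" by (simp add: assms(2) sr(1) power_mult_distrib)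
  finally have X: "X^2 + D * (p^2 * b')^2 = p^4 * c^2" by (simp add: b')
  then have "X^2 = (p^2)^2 * (c^2 - D * b'^2)" by (simp add: power_mult_distrib algebra_simps)
  then have "(p^2)^2 dvd X^2" by simp
  then have "p^2 dvd X" by (metis pow_divides_pow_iff pos2)
  then obtain a' where a': "X = p^2 * a'" by blast
  have "p^4 * (a'^2 + D * b'^2) = p^4 * c^2" using X unfolding a' by (simp add: power_mult_distrib algebra_simps)
  then have n: "a'^2 + D * b'^2 = c^2" using p0 by simp
  \<comment> \<open>Multiplying back by s + \<sigma> r sqrt(-D), of norm p^2, recovers p^2 times the
    original solution.\<close>
  have "p^2 * (a' * s - D * b' * (\<sigma> * r)) = X * s - D * (b * s - \<sigma> * a * r) * (\<sigma> * r)"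
    unfolding a' b' by (simp add: algebra_simps)
  also have "\<dots> = a * (s^2 + (\<sigma> * \<sigma>) * D * r^2)" unfolding X_def by (simp add: power2_eq_square algebra_simps)
  also have "\<dots> = p^2 * a" by (simp add: \<sigma>2 sr(1))
  finally have a: "a = a' * s - D * b' * (\<sigma> * r)" using p0 by simp
  have "p^2 * (a' * (\<sigma> * r) + b' * s) = X * (\<sigma> * r) + (b * s - \<sigma> * a * r) * s"
    unfolding a' b' by (simp add: algebra_simps)
  also have "\<dots> = b * (s^2 + (\<sigma> * \<sigma>) * D * r^2)" unfolding X_def by (simp add: power2_eq_square algebra_simps)
  also have "\<dots> = p^2 * b" by (simp add: \<sigma>2 sr(1))
  finally have b: "b = a' * (\<sigma> * r) + b' * s" using p0 by simp
  have "gcd (gcd a' b') c dvd gcd (gcd a b) (p * c)"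
  proof -
    let ?g = "gcd (gcd a' b') c"
    have "?g dvd a'" "?g dvd b'" "?g dvd c" by (meson gcd_dvd1 gcd_dvd2 dvd_trans)+
    then have "?g dvd a" "?g dvd b" "?g dvd p * c" unfolding a b by (simp_all add: dvd_diff)
    then show ?thesis by simp
  qed
  then have g: "gcd (gcd a' b') c = 1" using assms(3) by simp
  show ?thesis
    by (rule exI[of _ a'], rule exI[of _ b'], rule exI[of _ \<sigma>]) (intro conjI \<sigma>(1) n g a b)
qed

section \<open>Arithmetic of Z[sqrt(-D)] inside the complex numbers, and integrality at p\<close>

definition qint :: "int \<Rightarrow> int \<Rightarrow> int \<Rightarrow> complex" where
  "qint D a b = Complex (of_int a) (of_int b * sqrt (of_int D))"

lemma qint_eq_iff: "D > 0 \<Longrightarrow> qint D a b = qint D a' b' \<longleftrightarrow> a = a' \<and> b = b'"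
  by (auto simp: qint_def)

lemma qint_mult: "D \<ge> 0 \<Longrightarrow> qint D a b * qint D a' b' = qint D (a * a' - D * b * b') (a * b' + b * a')"
  by (simp add: qint_def complex_eq_iff algebra_simps)

lemma qint_scale: "of_int m * qint D a b = qint D (m * a) (m * b)"
  by (simp add: qint_def complex_eq_iff algebra_simps)

lemma qint_of_int: "qint D m 0 = of_int m"
  by (simp add: qint_def complex_eq_iff)

lemma cmod_qint: "D \<ge> 0 \<Longrightarrow> (cmod (qint D a b))^2 = of_int (a^2 + D * b^2)"
  by (simp add: qint_def cmod_power2 power_mult_distrib)

lemma qint_mult_conj: "D \<ge> 0 \<Longrightarrow> qint D a b * qint D a (-b) = of_int (a^2 + D * b^2)"
  by (simp add: qint_mult qint_of_int power2_eq_square mult.commute)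

lemma qint_prod:
  assumes "D \<ge> 0" "\<And>i. i \<in> A \<Longrightarrow> \<exists>a b. f i = qint D a b"
  shows "\<exists>a b. prod f A = qint D a b"
  using assms(2)
proof (induction A rule: infinite_finite_induct)
  case (insert i A)
  then obtain a b a' b' where "f i = qint D a b" "prod f A = qint D a' b'" by (metis insertCI)
  then show ?case using insert.hyps by (auto simp: qint_mult[OF assms(1)])
qed (use qint_of_int[of D 1] in auto)

text \<open>If \<open>s\<^sup>2 + D r\<^sup>2 = p\<^sup>2\<close> then \<open>z = s + r\<surd>-D\<close> satisfies \<open>z\<^sup>2 \<equiv> 2 s z\<close> modulo \<open>p\<close>, so its powers
  are never divisible by \<open>p\<close>.\<close>

lemma qint_power_not_dvd:
  fixes p :: int
  assumes "D \<ge> 0" "prime p" "odd p" "s^2 + D * r^2 = p^2" "\<not> p dvd s"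
  shows "\<exists>a b. qint D s r ^ n = qint D a b \<and> \<not> p dvd a"
proof -
  have p2: "\<not> p dvd 2 * s"
    using assms odd_prime_not_dvd_two by (simp add: prime_dvd_mult_iff)
  \<comment> \<open>Strengthened for the induction: the second condition is the same claim for the
    rational part of the next power.\<close>
  have "\<exists>a b. qint D s r ^ n = qint D a b \<and> \<not> p dvd a \<and> \<not> p dvd a * s - D * b * r"
  proof (induction n)
    case 0
    show ?case using assms(5) qint_of_int[of D 1] not_prime_unit assms(2) by (intro exI[of _ 1] exI[of _ 0]) auto
  next
    case (Suc n)
    then obtain a b where ab: "qint D s r ^ n = qint D a b" "\<not> p dvd a * s - D * b * r" by blast
    define a' where "a' = a * s - D * b * r"
    define b' where "b' = a * r + b * s"
    have "qint D s r ^ Suc n = qint D a' b'"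
      unfolding power_Suc2 ab(1) qint_mult[OF assms(1)] by (simp add: a'_def b'_def)
    \<comment> \<open>The recurrence z^(n+2) = 2 s z^(n+1) - p^2 z^n, read on rational
      parts.\<close>
    moreover have "a' * s - D * b' * r = a' * (2 * s) - a * (s^2 + D * r^2)"
      by (simp add: a'_def b'_def power2_eq_square algebra_simps)
    then have "a' * s - D * b' * r = a' * (2 * s) - p * (p * a)"
      unfolding assms(4) by (simp add: power2_eq_square algebra_simps)
    then have "\<not> p dvd a' * s - D * b' * r"
      using p2 ab(2) assms(2) unfolding a'_def[symmetric]
      by (metis dvd_diff_left_iff dvd_triv_left prime_dvd_mult_iff)
    ultimately show ?case using ab(2) unfolding a'_def[symmetric] by blast
  qed
  then show ?thesis by blast
qed

text \<open>The localisation of Z[sqrt(-D)] at the rational integers prime to p; it tests whether p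
  survives in the denominator.\<close>

definition integral_at :: "int \<Rightarrow> int \<Rightarrow> complex set" where
  "integral_at D p = {x. \<exists>m a b. \<not> p dvd m \<and> of_int m * x = qint D a b}"

text \<open>Rational integers prime to p are units of the localisation.\<close>

lemma integral_at_cancel:
  assumes "prime p" "\<not> p dvd d" "of_int d * x \<in> integral_at D p"
  shows "x \<in> integral_at D p"
proof -
  obtain m a b where "\<not> p dvd m" "of_int m * (of_int d * x) = qint D a b"
    using assms(3) by (auto simp: integral_at_def)
  then have "\<not> p dvd m * d" "of_int (m * d) * x = qint D a b"
    using assms by (auto simp: prime_dvd_mult_iff mult.assoc)
  then show ?thesis unfolding integral_at_def by blast
qed

lemma integral_at_qint: "prime p \<Longrightarrow> qint D a b \<in> integral_at D p"
  unfolding integral_at_def by (rule CollectI, rule exI[of _ 1]) (auto simp: not_prime_unit)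

lemma integral_at_mult:
  assumes "D \<ge> 0" "prime p" "x \<in> integral_at D p" "y \<in> integral_at D p"
  shows "x * y \<in> integral_at D p"
proof -
  obtain m a b n a' b' where 1: "\<not> p dvd m" "of_int m * x = qint D a b"
    "\<not> p dvd n" "of_int n * y = qint D a' b'"
    using assms(3,4) by (auto simp: integral_at_def)
  have "of_int (m * n) * (x * y) = (of_int m * x) * (of_int n * y)" by simp
  also have "\<dots> = qint D (a * a' - D * b * b') (a * b' + b * a')"
    unfolding 1 by (rule qint_mult[OF assms(1)])
  finally have "of_int (m * n) * (x * y) = \<dots>" .
  moreover have "\<not> p dvd m * n" using 1 assms(2) by (simp add: prime_dvd_mult_iff)
  ultimately show ?thesis unfolding integral_at_def by blast
qed

lemma integral_at_prod:
  assumes "D \<ge> 0" "prime p" "\<And>i. i \<in> A \<Longrightarrow> f i \<in> integral_at D p"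
  shows "prod f A \<in> integral_at D p"
  using assms(3)
proof (induction A rule: infinite_finite_induct)
  case (insert i A)
  then show ?case by (simp add: integral_at_mult assms(1,2))
qed (use integral_at_qint[OF assms(2), of D 1 0] in \<open>auto simp: qint_of_int\<close>)

section \<open>Products of powers of the u_p: exact denominators, independence, generation\<close>

text \<open>The class group acts on the rest of the argument only through these data: one element of
  norm p^2, not divisible by p, for each p in P. The last assumption says that P contains every
  prime occurring in a denominator.\<close>

locale split_prime_reps =
  fixes D :: int and P :: "nat set" and s r :: "nat \<Rightarrow> int"
  assumes D_gt_1: "D > 1" and squarefree_D: "squarefree D"
    and prime_P: "p \<in> P \<Longrightarrow> prime p" and odd_P: "p \<in> P \<Longrightarrow> odd p"
    and norm_P: "p \<in> P \<Longrightarrow> s p ^ 2 + D * r p ^ 2 = int p ^ 2"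
    and not_dvd_P: "p \<in> P \<Longrightarrow> \<not> int p dvd s p"
    and prime_divisor_in_P: "a^2 + D * b^2 = int c ^ 2 \<Longrightarrow> gcd (gcd a b) (int c) = 1 \<Longrightarrow>
      prime p \<Longrightarrow> p dvd c \<Longrightarrow> p \<in> P"
begin

lemma D_ge_0: "D \<ge> 0" and D_gt_0: "D > 0"
  using D_gt_1 by auto

definition u :: "nat \<Rightarrow> complex" where
  "u p = qint D (s p) (r p) / of_nat p"

definition exponents :: "(nat \<Rightarrow> int) set" where
  "exponents = {e. finite {p. e p \<noteq> 0} \<and> {p. e p \<noteq> 0} \<subseteq> P}"

definition uprod :: "(nat \<Rightarrow> int) \<Rightarrow> complex" where
  "uprod e = (\<Prod>p\<in>{p. e p \<noteq> 0}. u p powi e p)"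

definition denom :: "(nat \<Rightarrow> int) \<Rightarrow> nat" where
  "denom e = (\<Prod>p\<in>{p. e p \<noteq> 0}. p ^ nat \<bar>e p\<bar>)"

lemma cmod_u: "p \<in> P \<Longrightarrow> cmod (u p) = 1"
proof -
  assume p: "p \<in> P"
  have "(cmod (qint D (s p) (r p)))^2 = (real p)^2"
    unfolding cmod_qint[OF D_ge_0] norm_P[OF p] by simp
  then have "cmod (qint D (s p) (r p)) = real p" by (rule power2_eq_imp_eq) simp_all
  then show ?thesis using prime_P[OF p] by (simp add: u_def norm_divide prime_gt_0_nat)
qed

lemma u_nonzero: "p \<in> P \<Longrightarrow> u p \<noteq> 0"
  using cmod_u by fastforce

lemma inverse_u: "p \<in> P \<Longrightarrow> inverse (u p) = qint D (s p) (- r p) / of_nat p"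
proof -
  assume p: "p \<in> P"
  have "u p * (qint D (s p) (- r p) / of_nat p) = 1"
    using qint_mult_conj[OF D_ge_0, of "s p" "r p"] prime_P[OF p]
    unfolding norm_P[OF p] by (simp add: u_def power2_eq_square prime_gt_0_nat)
  then show ?thesis by (rule inverse_unique)
qed

text \<open>Negative powers of \<open>u p\<close> are positive powers of its conjugate, and (s, -r)
  satisfies the same conditions as (s, r).\<close>

lemma u_powi_qint:
  assumes p: "p \<in> P"
  shows "\<exists>a b. of_nat (p ^ nat \<bar>k\<bar>) * u p powi k = qint D a b \<and> \<not> int p dvd a"
proof -
  have p': "prime (int p)" "odd (int p)" "p > 0" using prime_P[OF p] odd_P[OF p] by (auto simp: prime_gt_0_nat)
  show ?thesis
  proof (cases "k \<ge> 0")
    case True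
    then have "of_nat (p ^ nat \<bar>k\<bar>) * u p powi k = qint D (s p) (r p) ^ nat \<bar>k\<bar>"
      using p'(3) by (simp add: u_def power_int_nonneg_exp power_divide)
    then show ?thesis
      using qint_power_not_dvd[OF D_ge_0 p'(1,2) norm_P[OF p] not_dvd_P[OF p], of "nat \<bar>k\<bar>"] by simp
  next
    case False
    then have "u p powi k = inverse (u p) ^ nat \<bar>k\<bar>"
      by (simp add: power_int_def)
    then have "of_nat (p ^ nat \<bar>k\<bar>) * u p powi k = qint D (s p) (- r p) ^ nat \<bar>k\<bar>"
      using p'(3) by (simp add: inverse_u[OF p] power_divide)
    moreover have "s p ^ 2 + D * (- r p)^2 = int p ^ 2" using norm_P[OF p] by simp
    ultimately show ?thesis
      using qint_power_not_dvd[OF D_ge_0 p'(1,2) _ not_dvd_P[OF p], of "- r p" "nat \<bar>k\<bar>"] by simp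
  qed
qed

text \<open>The exponent is one less than what clears the denominator. Were the product integral
  after scaling by some m prime to p, then one more factor p would make m a divisible by p, where a
  is a coordinate that p does not divide.\<close>

lemma u_powi_not_integral_at:
  assumes p: "p \<in> P" and k: "k \<noteq> 0"
  shows "of_nat (p ^ (nat \<bar>k\<bar> - 1)) * u p powi k \<notin> integral_at D (int p)"
proof
  have pp: "prime (int p)" using prime_P[OF p] by simp
  assume "of_nat (p ^ (nat \<bar>k\<bar> - 1)) * u p powi k \<in> integral_at D (int p)"
  then obtain m a' b' where m: "\<not> int p dvd m"
    "of_int m * (of_nat (p ^ (nat \<bar>k\<bar> - 1)) * u p powi k) = qint D a' b'"
    by (auto simp: integral_at_def)
  obtain a b where ab: "of_nat (p ^ nat \<bar>k\<bar>) * u p powi k = qint D a b" "\<not> int p dvd a"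
    using u_powi_qint[OF p] by blast
  have "p ^ nat \<bar>k\<bar> = p * p ^ (nat \<bar>k\<bar> - 1)"
    using k by (metis power_Suc Suc_diff_1 zero_less_abs_iff zero_less_nat_eq)
  then have "of_int m * (of_nat (p ^ nat \<bar>k\<bar>) * u p powi k) = of_int (int p) * qint D a' b'"
    unfolding m(2)[symmetric] by simp
  then have "qint D (m * a) (m * b) = qint D (int p * a') (int p * b')"
    unfolding ab(1) by (simp only: qint_scale)
  then have "m * a = int p * a'" by (simp add: qint_eq_iff[OF D_gt_0])
  then have "int p dvd m * a" by simp
  then show False using m(1) ab(2) pp by (simp add: prime_dvd_mult_iff)
qed

text \<open>A power of p clears the denominator, and it is prime to q.\<close>

lemma u_powi_integral_at:
  assumes "p \<in> P" "q \<in> P" "p \<noteq> q"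
  shows "u p powi k \<in> integral_at D (int q)"
proof -
  obtain a b where "of_nat (p ^ nat \<bar>k\<bar>) * u p powi k = qint D a b"
    using u_powi_qint[OF assms(1)] by blast
  moreover have "\<not> int q dvd int (p ^ nat \<bar>k\<bar>)"
    using assms prime_P by (metis int_dvd_int_iff prime_dvd_power primes_dvd_imp_eq)
  ultimately show ?thesis unfolding integral_at_def by (metis (mono_tags, lifting) mem_Collect_eq of_int_of_nat_eq)
qed

lemma uprod_superset:
  assumes "finite A" "{p. e p \<noteq> 0} \<subseteq> A"
  shows "uprod e = (\<Prod>p\<in>A. u p powi e p)"
  unfolding uprod_def using assms by (intro prod.mono_neutral_left) auto

lemma exponents_add:
  assumes "e \<in> exponents" "e' \<in> exponents"
  shows "(\<lambda>p. e p + e' p) \<in> exponents"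
proof -
  have "{p. e p + e' p \<noteq> 0} \<subseteq> {p. e p \<noteq> 0} \<union> {p. e' p \<noteq> 0}" by auto
  moreover have "finite ({p. e p \<noteq> 0} \<union> {p. e' p \<noteq> 0})" "{p. e p \<noteq> 0} \<union> {p. e' p \<noteq> 0} \<subseteq> P"
    using assms by (simp_all add: exponents_def)
  ultimately show ?thesis unfolding exponents_def by (blast intro: finite_subset)
qed

lemma exponents_minus: "e \<in> exponents \<Longrightarrow> (\<lambda>p. - e p) \<in> exponents"
  unfolding exponents_def by simp

lemma exponents_single: "p \<in> P \<Longrightarrow> (\<lambda>q. if q = p then k else 0) \<in> exponents"
  unfolding exponents_def using finite_subset[of "{q. q = p \<and> k \<noteq> 0}" "{p}"] by auto

lemma uprod_single: "uprod (\<lambda>q. if q = p then k else 0) = u p powi k"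
  by (subst uprod_superset[of "{p}"]) auto

lemma uprod_zero: "uprod (\<lambda>p. 0) = 1"
  by (simp add: uprod_def)

lemma uprod_add:
  assumes "e \<in> exponents" "e' \<in> exponents"
  shows "uprod (\<lambda>p. e p + e' p) = uprod e * uprod e'"
proof -
  let ?A = "{p. e p \<noteq> 0} \<union> {p. e' p \<noteq> 0}"
  have A: "finite ?A" "?A \<subseteq> P" using assms by (auto simp: exponents_def)
  have "uprod (\<lambda>p. e p + e' p) = (\<Prod>p\<in>?A. u p powi (e p + e' p))"
    using A(1) by (intro uprod_superset) auto
  also have "\<dots> = (\<Prod>p\<in>?A. u p powi e p * u p powi e' p)"
    using A(2) u_nonzero by (intro prod.cong refl power_int_add) blast
  also have "\<dots> = (\<Prod>p\<in>?A. u p powi e p) * (\<Prod>p\<in>?A. u p powi e' p)" by (rule prod.distrib)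
  also have "\<dots> = uprod e * uprod e'"
    using A(1) uprod_superset[of ?A e] uprod_superset[of ?A e'] by auto
  finally show ?thesis .
qed

lemma uprod_minus: "uprod (\<lambda>p. - e p) = inverse (uprod e)"
  by (simp add: uprod_def power_int_minus prod_inversef[unfolded comp_def])

lemma cmod_uprod: "e \<in> exponents \<Longrightarrow> cmod (uprod e) = 1"
  unfolding uprod_def prod_norm[symmetric] norm_power_int
  by (rule prod.neutral) (auto simp: exponents_def cmod_u subset_iff)

lemma uprod_nonzero: "e \<in> exponents \<Longrightarrow> uprod e \<noteq> 0"
  using cmod_uprod by fastforce

lemma denom_pos: "e \<in> exponents \<Longrightarrow> denom e > 0"
  unfolding denom_def by (rule prod_pos) (auto simp: exponents_def prime_P prime_gt_0_nat subset_iff)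

lemma prime_dvd_denom:
  assumes "e \<in> exponents" "prime q"
  shows "q dvd denom e \<longleftrightarrow> e q \<noteq> 0"
proof
  assume "q dvd denom e"
  then obtain p where "e p \<noteq> 0" "q dvd p ^ nat \<bar>e p\<bar>"
    using assms unfolding denom_def exponents_def by (auto simp: prime_dvd_prod_iff)
  then show "e q \<noteq> 0"
    using assms prime_P unfolding exponents_def by (metis (mono_tags) mem_Collect_eq prime_dvd_power primes_dvd_imp_eq subsetD)
next
  assume q: "e q \<noteq> 0"
  then have "q dvd q ^ nat \<bar>e q\<bar>" by (intro dvd_power) auto
  also have "\<dots> dvd denom e"
    unfolding denom_def using assms(1) q by (intro dvd_prodI) (auto simp: exponents_def)
  finally show "q dvd denom e" .
qed

lemma multiplicity_denom:
  assumes "e \<in> exponents" "prime q"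
  shows "multiplicity q (denom e) = nat \<bar>e q\<bar>"
  unfolding denom_def using assms prime_P
  by (subst multiplicity_prod_prime_powers) (auto simp: exponents_def)

text \<open>The local denominators together clear the product, and absolute value 1 yields the
  equation. The real content is that the fraction is already reduced.\<close>

lemma uprod_fraction:
  assumes e: "e \<in> exponents"
  obtains a b where "uprod e = qint D a b / of_nat (denom e)" "a^2 + D * b^2 = int (denom e) ^ 2"
    "gcd (gcd a b) (int (denom e)) = 1"
proof -
  let ?S = "{p. e p \<noteq> 0}"
  have S: "finite ?S" "?S \<subseteq> P" using e by (auto simp: exponents_def)
  have eq: "of_nat (denom e) * uprod e = (\<Prod>p\<in>?S. of_nat (p ^ nat \<bar>e p\<bar>) * u p powi e p)"
    by (simp add: denom_def uprod_def prod.distrib)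
  have "\<exists>a b. of_nat (denom e) * uprod e = qint D a b"
    unfolding eq using S(2) u_powi_qint by (intro qint_prod[OF D_ge_0]) blast
  then obtain a b where ab: "of_nat (denom e) * uprod e = qint D a b" by blast
  have "of_int (a^2 + D * b^2) = (of_int (int (denom e) ^ 2) :: real)"
    unfolding cmod_qint[OF D_ge_0, symmetric] ab[symmetric]
    by (simp add: norm_mult cmod_uprod[OF e] power2_eq_square)
  then have n: "a^2 + D * b^2 = int (denom e) ^ 2" by (simp only: of_int_eq_iff)
  have "gcd (gcd a b) (int (denom e)) = 1"
  proof (rule ccontr)
    assume "gcd (gcd a b) (int (denom e)) \<noteq> 1"
    then obtain q' where q': "prime q'" "q' dvd gcd (gcd a b) (int (denom e))"
      using prime_divisorE[of "gcd (gcd a b) (int (denom e))"] denom_pos[OF e]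
      by (metis gcd_eq_0_iff gcd_ge_0_int int_one_le_iff_zero_less is_unit_gcd_iff less_irrefl of_nat_0_less_iff zdvd1_eq abs_of_nonneg)
    define q where "q = nat q'"
    have q: "int q = q'" using q'(1) prime_ge_0_int by (simp add: q_def)
    have pq: "prime q" "prime (int q)" using q q'(1) by auto
    obtain a' b' where ab': "a = int q * a'" "b = int q * b'" using q'(2) unfolding q by (auto elim!: dvdE)
    have "q dvd denom e" using q'(2) unfolding q[symmetric] by simp
    then have eq0: "e q \<noteq> 0" using prime_dvd_denom[OF e pq(1)] by simp
    then have qP: "q \<in> P" using S by blast
    \<comment> \<open>\<open>d\<close> and \<open>R\<close> collect what the primes other than q
      contribute to the denominator and to the product.\<close>
    let ?S' = "?S - {q}"
    define d where "d = (\<Prod>p\<in>?S'. p ^ nat \<bar>e p\<bar>)"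
    \<comment> \<open>One factor q is split off because it cancels against the common factor q of a
      and b; this leaves the exponent that is one too small to clear the power of
      \<open>u q\<close>.\<close>
    have dd: "denom e = q * (q ^ (nat \<bar>e q\<bar> - 1) * d)"
      unfolding denom_def d_def using S(1) eq0
      by (simp add: prod.remove[of ?S q] flip: power_Suc mult.assoc)
    have qd: "\<not> q dvd d"
    proof
      assume "q dvd d"
      then obtain p where p: "p \<in> ?S'" "q dvd p ^ nat \<bar>e p\<bar>"
        using pq(1) S(1) unfolding d_def by (auto simp: prime_dvd_prod_iff)
      then have "q = p" using pq(1) prime_P S(2) by (meson DiffD1 prime_dvd_power primes_dvd_imp_eq subsetD)
      then show False using p(1) by simp
    qed
    define R where "R = (\<Prod>p\<in>?S'. u p powi e p)"
    have uR: "uprod e = u q powi e q * R"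
      unfolding uprod_def R_def using S(1) eq0 by (simp add: prod.remove[of ?S q])
    have R0: "R \<noteq> 0" using uprod_nonzero[OF e] uR by auto
    have "inverse R = (\<Prod>p\<in>?S'. u p powi (- e p))"
      by (simp add: R_def power_int_minus prod_inversef[unfolded comp_def])
    also have "\<dots> \<in> integral_at D (int q)"
      using S(2) qP by (intro integral_at_prod[OF D_ge_0 pq(2)] u_powi_integral_at) auto
    finally have Rq: "inverse R \<in> integral_at D (int q)" .
    define x where "x = of_nat (q ^ (nat \<bar>e q\<bar> - 1)) * u q powi e q"
    have "of_int (int q) * (of_int (int d) * x * R) = of_nat (denom e) * uprod e"
      unfolding dd uR x_def by simp
    also have "\<dots> = of_int (int q) * qint D a' b'" unfolding ab ab' by (simp only: qint_scale)
    finally have "of_int (int d) * x * R = qint D a' b'" using pq(1) by (auto simp: prime_gt_0_nat)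
    \<comment> \<open>As the inverse of \<open>R\<close> is integral at q and \<open>d\<close> is
      prime to q, \<open>x\<close> would be integral at q.\<close>
    then have "of_int (int d) * x = qint D a' b' * inverse R" using R0 by (simp add: field_simps)
    also have "\<dots> \<in> integral_at D (int q)"
      by (intro integral_at_mult[OF D_ge_0 pq(2)] integral_at_qint pq Rq)
    finally have "x \<in> integral_at D (int q)" by (rule integral_at_cancel[OF pq(2), rotated]) (use qd in simp)
    then show False using u_powi_not_integral_at[OF qP eq0] by (simp add: x_def)
  qed
  moreover have "uprod e = qint D a b / of_nat (denom e)"
    using ab denom_pos[OF e] by (simp add: field_simps)
  ultimately show ?thesis by (metis that n)
qed

text \<open>A sign has reduced denominator 1, while each prime with nonzero exponent divides
  \<open>denom e\<close>.\<close>

lemma uprod_eq_sign: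
  assumes e: "e \<in> exponents" and "uprod e = of_int \<epsilon>" "\<epsilon> \<in> {1, -1}"
  shows "e = (\<lambda>p. 0)"
proof -
  obtain a b where ab: "uprod e = qint D a b / of_nat (denom e)" "a^2 + D * b^2 = int (denom e) ^ 2"
    "gcd (gcd a b) (int (denom e)) = 1"
    by (rule uprod_fraction[OF e])
  have "qint D a b = qint D (int (denom e) * \<epsilon>) 0"
    using ab(1) assms(2) denom_pos[OF e] by (simp add: qint_of_int field_simps)
  then have "a = int (denom e) * \<epsilon>" "b = 0" by (simp_all add: qint_eq_iff[OF D_gt_0])
  then have "denom e = 1" using ab(3) assms(3) by auto
  have "e q = 0" for q
  proof (rule ccontr)
    assume "e q \<noteq> 0"
    then have "prime q" using e prime_P by (auto simp: exponents_def)
    then have "q dvd 1" using prime_dvd_denom[OF e] \<open>e q \<noteq> 0\<close> \<open>denom e = 1\<close> by simp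
    then show False using \<open>prime q\<close> by simp
  qed
  then show ?thesis by blast
qed

text \<open>The quotient of the two products is again a sign, because signs are their own inverses;
  hence all exponents of the quotient vanish.\<close>

lemma signed_uprod_inj:
  assumes "e \<in> exponents" "e' \<in> exponents" "\<epsilon> \<in> {1, -1}" "\<epsilon>' \<in> {1, -1}"
    "of_int \<epsilon> * uprod e = of_int \<epsilon>' * uprod e'"
  shows "\<epsilon> = \<epsilon>'" "e = e'"
proof -
  have "uprod (\<lambda>p. e p + - e' p) = uprod e * inverse (uprod e')"
    unfolding uprod_minus[symmetric] by (rule uprod_add[OF assms(1) exponents_minus[OF assms(2)]])
  also have "\<dots> = of_int (\<epsilon> * \<epsilon>')"
    using assms(3-5) uprod_nonzero[OF assms(2)] by (auto simp: field_simps, metis minus_minus)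
  finally have "(\<lambda>p. e p + - e' p) = (\<lambda>p. 0)"
    by (rule uprod_eq_sign[OF exponents_add[OF assms(1) exponents_minus[OF assms(2)]]]) (use assms(3,4) in auto)
  then show "e = e'" by (auto simp: fun_eq_iff)
  then show "\<epsilon> = \<epsilon>'" using assms(5) uprod_nonzero[OF assms(2)] by simp
qed

text \<open>Strong induction on the denominator. At c = 1 the bound D > 1 forces b = 0.\<close>

lemma primitive_solution_uprod:
  fixes c :: nat
  assumes "c > 0" "a^2 + D * b^2 = int c ^ 2" "gcd (gcd a b) (int c) = 1"
  shows "\<exists>\<epsilon>\<in>{1, -1}. \<exists>e\<in>exponents. qint D a b / of_nat c = of_int \<epsilon> * uprod e"
  using assms
proof (induction c arbitrary: a b rule: less_induct)
  case (less c)
  show ?case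
  proof (cases "c = 1")
    case True
    have "b = 0"
    proof (rule ccontr)
      assume "b \<noteq> 0"
      then have "D * 1 \<le> D * b^2" using D_gt_0 by (intro mult_left_mono) (auto simp: int_one_le_iff_zero_less)
      moreover have "a^2 + D * b^2 = 1" using less.prems(2) True by simp
      ultimately show False using D_gt_1 zero_le_power2[of a] by linarith
    qed
    then have "a \<in> {1, -1}" "qint D a b / of_nat c = of_int a * uprod (\<lambda>p. 0)"
      using less.prems(2) True by (auto simp: power2_eq_1_iff qint_of_int uprod_zero)
    moreover have "(\<lambda>p. 0) \<in> exponents" by (simp add: exponents_def)
    ultimately show ?thesis by blast
  next
    case False
    then obtain p where p: "prime p" "p dvd c" using prime_factor_nat by blast
    have pP: "p \<in> P" by (rule prime_divisor_in_P[OF less.prems(2,3) p])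
    obtain c' where c': "c = p * c'" using p(2) by blast
    have c'0: "c' > 0" using less.prems(1) unfolding c' by simp
    then have c'lt: "c' < c" unfolding c' using prime_gt_1_nat[OF p(1)] by simp
    have "prime (int p)" "odd (int p)" using p(1) odd_P[OF pP] by auto
    note descent = primitive_solution_descent[OF squarefree_D _ _ this norm_P[OF pP] not_dvd_P[OF pP]]
    obtain a' b' \<sigma> where \<sigma>: "\<sigma> \<in> {1, -1}" and n: "a'^2 + D * b'^2 = int c' ^ 2" "gcd (gcd a' b') (int c') = 1"
      and ab: "a = a' * s p - D * b' * (\<sigma> * r p)" "b = a' * (\<sigma> * r p) + b' * s p"
      using descent[OF less.prems(2,3)[unfolded c' of_nat_mult]] by (elim exE conjE) (rule that)
    obtain \<epsilon> e where e: "\<epsilon> \<in> {1, -1}" "e \<in> exponents" "qint D a' b' / of_nat c' = of_int \<epsilon> * uprod e"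
      using less.IH[OF c'lt c'0 n] by blast
    let ?e = "\<lambda>q. e q + (if q = p then \<sigma> else 0)"
    \<comment> \<open>The sign \<sigma> from the descent doubles as an exponent, since inverting
      \<open>u p\<close> is conjugating it.\<close>
    have up: "u p powi \<sigma> = qint D (s p) (\<sigma> * r p) / of_nat p"
    proof (cases "\<sigma> = 1")
      case False
      then have "\<sigma> = -1" using \<sigma> by simp
      then show ?thesis using inverse_u[OF pP] by (simp add: power_int_minus)
    qed (simp add: u_def)
    have "qint D a b / of_nat c = (qint D a' b' / of_nat c') * (qint D (s p) (\<sigma> * r p) / of_nat p)"
      unfolding ab c' times_divide_times_eq qint_mult[OF D_ge_0] of_nat_mult by (simp only: mult.commute)
    also have "\<dots> = of_int \<epsilon> * (uprod e * u p powi \<sigma>)"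
      unfolding e(3) up by simp
    also have "\<dots> = of_int \<epsilon> * uprod ?e"
      by (simp only: uprod_add[OF e(2) exponents_single[OF pP]] uprod_single)
    finally show ?thesis by (intro bexI[OF _ e(1)] bexI[OF _ exponents_add[OF e(2) exponents_single[OF pP]]])
  qed
qed

end

section \<open>Elements of G_D(Q) as reduced fractions\<close>

lemma qint_fraction_in_G_D:
  assumes "D > 0" "c > 0" "a^2 + D * b^2 = int c ^ 2"
  shows "qint D a b / of_nat c \<in> G_D D"
proof -
  have "rat_of_int a ^ 2 + of_int D * of_int b ^ 2 = of_nat c ^ 2"
    using arg_cong[OF assms(3), of rat_of_int] by simp
  then have "(of_int a / of_nat c)^2 + of_int D * (of_int b / of_nat c)^2 = (1::rat)"
    using assms(2) by (simp add: power_divide flip: add_divide_distrib)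
  moreover have "qint D a b / of_nat c = of_real (of_rat (of_int a / of_nat c))
      + of_real (of_rat (of_int b / of_nat c)) * \<i> * of_real (sqrt (of_int D))"
    by (simp add: qint_def complex_eq_iff of_rat_divide)
  ultimately show ?thesis unfolding G_D_def by blast
qed

text \<open>Both coordinates are brought to the denominator m n; the gcd \<open>g\<close> of the two
  numerators and m n is then divided out.\<close>

lemma G_D_fraction:
  assumes "D > 0" "z \<in> G_D D"
  obtains a b c where "c > 0" "a^2 + D * b^2 = int c ^ 2" "gcd (gcd a b) (int c) = 1"
    "z = qint D a b / of_nat c"
proof -
  obtain x y :: rat where z: "z = of_real (of_rat x) + of_real (of_rat y) * \<i> * of_real (sqrt (of_int D))"
    and xy: "x^2 + of_int D * y^2 = 1"
    using assms(2) unfolding G_D_def by blast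
  obtain A m where x: "x = of_int A / of_int m" "m > 0" by (metis quotient_of_div quotient_of_denom_pos surj_pair)
  obtain B n where y: "y = of_int B / of_int n" "n > 0" by (metis quotient_of_div quotient_of_denom_pos surj_pair)
  define g where "g = gcd (gcd (A * n) (B * m)) (m * n)"
  have "g dvd A * n" "g dvd B * m" "g dvd m * n"
    unfolding g_def by (meson gcd_dvd1 gcd_dvd2 dvd_trans)+
  then obtain a b c where abc: "A * n = g * a" "B * m = g * b" "m * n = g * c" by (elim dvdE)
  have "g > 0" using x(2) y(2) by (simp add: g_def)
  moreover have "m * n > 0" using x(2) y(2) by simp
  ultimately have c: "c > 0" unfolding abc(3) by (simp add: zero_less_mult_iff)
  have x': "x = of_int a / of_int c"
  proof -
    have "x = of_int (A * n) / of_int (m * n)" using x y by simp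
    then show ?thesis unfolding abc using \<open>g > 0\<close> by simp
  qed
  have y': "y = of_int b / of_int c"
  proof -
    have "y = of_int (B * m) / of_int (m * n)" using x y by simp
    then show ?thesis unfolding abc using \<open>g > 0\<close> by simp
  qed
  have "g * gcd (gcd a b) c = gcd (gcd (g * a) (g * b)) (g * c)"
    using \<open>g > 0\<close> by (simp add: gcd_mult_distrib_int[of g, symmetric])
  also have "\<dots> = g" using g_def unfolding abc by (rule sym)
  finally have gcd1: "gcd (gcd a b) c = 1" using \<open>g > 0\<close> by simp
  have "rat_of_int (a^2 + D * b^2) = of_int (c^2)"
    using xy c unfolding x' y' by (simp add: power_divide field_simps)
  then have n: "a^2 + D * b^2 = c^2" by (simp only: of_int_eq_iff)
  have "z = qint D a b / of_int c"
    unfolding z x' y' by (simp add: qint_def complex_eq_iff of_rat_divide)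
  then show ?thesis using that[of "nat c" a b] c n gcd1 by simp
qed

text \<open>Cross-multiplication shows that c divides c' a, c' b and c' c, hence c' gcd(a, b, c) =
  c'; the converse is symmetric.\<close>

lemma primitive_fraction_unique:
  assumes "D > 0" "c > 0" "c' > 0" "gcd (gcd a b) (int c) = 1" "gcd (gcd a' b') (int c') = 1"
    and "qint D a b / of_nat c = qint D a' b' / of_nat c'"
  shows "a = a'" "b = b'" "c = c'"
proof -
  have dvd: "int c dvd int c'" if "int c' * a = int c * a'" "int c' * b = int c * b'" "gcd (gcd a b) (int c) = 1"
    for a b a' b' c c'
  proof -
    have "int c dvd gcd (gcd (int c' * a) (int c' * b)) (int c' * int c)" using that(1,2) by simp
    also have "\<dots> = int c' * gcd (gcd a b) (int c)" by (simp add: gcd_mult_distrib_int[symmetric])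
    finally show ?thesis using that(3) by simp
  qed
  have "of_int (int c') * qint D a b = of_int (int c) * qint D a' b'"
    using assms(2,3,6) by (simp add: field_simps)
  then have eq: "int c' * a = int c * a'" "int c' * b = int c * b'"
    unfolding qint_scale qint_eq_iff[OF assms(1)] by auto
  have "int c dvd int c'" by (rule dvd[OF eq assms(4)])
  moreover have "int c' dvd int c" by (rule dvd[OF eq[symmetric] assms(5)])
  ultimately show "c = c'" by (simp add: dvd_antisym)
  then show "a = a'" "b = b'" using eq assms(3) by auto
qed

section \<open>Counting signs of exponents and of coordinates\<close>

text \<open>Such an e is determined by the set of points where it is positive; n > 0 on A keeps the
  two signs apart.\<close>

lemma card_sign_choices:
  fixes n :: "'a \<Rightarrow> int"
  assumes "finite A" "\<And>p. p \<in> A \<Longrightarrow> n p > 0"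
  shows "card {e. \<forall>p. \<bar>e p\<bar> = (if p \<in> A then n p else 0)} = 2 ^ card A"
proof -
  let ?T = "{e. \<forall>p. \<bar>e p\<bar> = (if p \<in> A then n p else 0)}"
  let ?f = "\<lambda>S p. if p \<in> S then n p else if p \<in> A then - n p else 0"
  have "bij_betw ?f (Pow A) ?T"
  proof (rule bij_betw_byWitness[where f' = "\<lambda>e. {p. e p > 0}"])
    show "\<forall>S\<in>Pow A. {p. ?f S p > 0} = S" using assms(2) by (force split: if_splits)
    show "\<forall>e\<in>?T. ?f {p. e p > 0} = e"
    proof (intro ballI ext)
      fix e p assume "e \<in> ?T"
      then have "\<bar>e p\<bar> = (if p \<in> A then n p else 0)" by blast
      then show "?f {p. e p > 0} p = e p" by (auto split: if_splits)
    qed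
    show "?f ` Pow A \<subseteq> ?T" using assms(2) by (auto simp: subset_iff less_imp_le abs_of_pos)
    show "(\<lambda>e. {p. e p > 0}) ` ?T \<subseteq> Pow A"
    proof clarify
      fix e p assume "\<forall>p. \<bar>e p\<bar> = (if p \<in> A then n p else 0)" "e p > (0::int)"
      then have "(if p \<in> A then n p else 0) > 0" by (metis abs_of_pos)
      then show "p \<in> A" by (simp split: if_splits)
    qed
  qed
  then have "card (Pow A) = card ?T" by (rule bij_betw_same_card)
  then show ?thesis using assms(1) by (simp add: card_Pow)
qed

text \<open>Integer coordinates of either sign, so that solutions correspond to the elements of
  G_D(Q) with reduced denominator c.\<close>

definition primitive_solutions :: "int \<Rightarrow> nat \<Rightarrow> (int \<times> int) set" where
  "primitive_solutions D c = {(a, b). a^2 + D * b^2 = int c ^ 2 \<and> gcd (gcd a b) (int c) = 1}"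

lemma normalized_iff_primitive:
  "(a, b) \<in> normalized_solutions D c \<longleftrightarrow> (int a, int b) \<in> primitive_solutions D c"
proof -
  have "gcd (gcd (int a) (int b)) (int c) = int (gcd (gcd a b) c)" by simp
  then show ?thesis by (simp add: normalized_solutions_def primitive_solutions_def del: gcd_int_int_eq)
qed

text \<open>Neither coordinate of a primitive solution vanishes, so the four sign changes are distinct.\<close>

lemma card_primitive_solutions_normalized:
  assumes "squarefree D" "c > 1"
  shows "card (primitive_solutions D c) = 4 * card (normalized_solutions D c)"
proof -
  obtain p where p: "prime p" "p dvd c" using prime_factor_nat[of c] assms(2) by auto
  \<comment> \<open>A prime divisor of c divides neither coordinate, which rules out 0.\<close>
  have nz: "a \<noteq> 0" "b \<noteq> 0" if "(a, b) \<in> primitive_solutions D c" for a b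
    using primitive_solution_not_dvd[of D a b "int c" "int p"] that p assms(1)
    by (auto simp: primitive_solutions_def)
  have sign: "(\<sigma> * a, \<tau> * b) \<in> primitive_solutions D c \<longleftrightarrow> (a, b) \<in> primitive_solutions D c"
    if "\<sigma> \<in> {1, -1}" "\<tau> \<in> {1, -1}" for \<sigma> \<tau> a b
    using that by (auto simp: primitive_solutions_def)
  let ?N = "normalized_solutions D c" and ?S = "{1, -1 :: int}"
  have "bij_betw (\<lambda>((\<sigma>, \<tau>), (a, b)). (\<sigma> * int a, \<tau> * int b)) ((?S \<times> ?S) \<times> ?N) (primitive_solutions D c)"
  proof (rule bij_betw_byWitness[where f' = "\<lambda>(a, b). ((sgn a, sgn b), (nat \<bar>a\<bar>, nat \<bar>b\<bar>))"])
    show "\<forall>x\<in>(?S \<times> ?S) \<times> ?N. (\<lambda>(a, b). ((sgn a, sgn b), nat \<bar>a\<bar>, nat \<bar>b\<bar>))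
        ((\<lambda>((\<sigma>, \<tau>), a, b). (\<sigma> * int a, \<tau> * int b)) x) = x"
    proof
      fix x assume x: "x \<in> (?S \<times> ?S) \<times> ?N"
      obtain \<sigma> \<tau> a b where xeq: "x = ((\<sigma>, \<tau>), (a, b))" by (metis surj_pair)
      have "\<sigma> \<in> ?S" "\<tau> \<in> ?S" and N: "(a, b) \<in> ?N" 
        using x unfolding xeq mem_Sigma_iff by blast+
      moreover have "a > 0" "b > 0"
        using nz[of "int a" "int b"] N by (simp_all add: normalized_iff_primitive)
      ultimately show "(\<lambda>(a, b). ((sgn a, sgn b), nat \<bar>a\<bar>, nat \<bar>b\<bar>))
          ((\<lambda>((\<sigma>, \<tau>), a, b). (\<sigma> * int a, \<tau> * int b)) x) = x"
        unfolding xeq by (auto simp: sgn_if abs_mult)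
    qed
    show "\<forall>x\<in>primitive_solutions D c. (\<lambda>((\<sigma>, \<tau>), a, b). (\<sigma> * int a, \<tau> * int b))
        ((\<lambda>(a, b). ((sgn a, sgn b), nat \<bar>a\<bar>, nat \<bar>b\<bar>)) x) = x"
      by (auto simp: sgn_mult_abs)
    show "(\<lambda>((\<sigma>, \<tau>), a, b). (\<sigma> * int a, \<tau> * int b)) ` ((?S \<times> ?S) \<times> ?N) \<subseteq> primitive_solutions D c"
    proof (rule image_subsetI)
      fix x assume x: "x \<in> (?S \<times> ?S) \<times> ?N"
      obtain \<sigma> \<tau> a b where xeq: "x = ((\<sigma>, \<tau>), (a, b))" by (metis surj_pair)
      have "\<sigma> \<in> ?S" "\<tau> \<in> ?S" "(a, b) \<in> ?N" using x unfolding xeq mem_Sigma_iff by blast+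
      then show "(\<lambda>((\<sigma>, \<tau>), a, b). (\<sigma> * int a, \<tau> * int b)) x \<in> primitive_solutions D c"
        unfolding xeq prod.case by (simp only: sign normalized_iff_primitive)
    qed
    show "(\<lambda>(a, b). ((sgn a, sgn b), nat \<bar>a\<bar>, nat \<bar>b\<bar>)) ` primitive_solutions D c \<subseteq> (?S \<times> ?S) \<times> ?N"
    proof (rule image_subsetI)
      fix x assume x: "x \<in> primitive_solutions D c"
      obtain a b where xeq: "x = (a, b)" by (cases x)
      then have ab: "(a, b) \<in> primitive_solutions D c" using x by simp
      then have s: "sgn a \<in> ?S" "sgn b \<in> ?S" using nz by (auto simp: sgn_if)
      have "(sgn a * \<bar>a\<bar>, sgn b * \<bar>b\<bar>) \<in> primitive_solutions D c" using ab by (simp add: sgn_mult_abs)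
      then have "(nat \<bar>a\<bar>, nat \<bar>b\<bar>) \<in> ?N" using sign[OF s] by (simp add: normalized_iff_primitive)
      then show "(\<lambda>(a, b). ((sgn a, sgn b), nat \<bar>a\<bar>, nat \<bar>b\<bar>)) x \<in> (?S \<times> ?S) \<times> ?N"
        unfolding xeq prod.case using s by blast
    qed
  qed
  from bij_betw_same_card[OF this] show ?thesis by (simp add: card_cartesian_product)
qed

section \<open>The group structure of G_D(Q) and the number of primitive solutions\<close>

context split_prime_reps
begin

lemma exponents_zero: "(\<lambda>p. 0) \<in> exponents"
  by (simp add: exponents_def)

lemma uprod_in_G_D: "e \<in> exponents \<Longrightarrow> uprod e \<in> G_D D"
proof -
  assume e: "e \<in> exponents"
  obtain a b where "uprod e = qint D a b / of_nat (denom e)" "a^2 + D * b^2 = int (denom e) ^ 2"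
    "gcd (gcd a b) (int (denom e)) = 1" by (rule uprod_fraction[OF e])
  then show "uprod e \<in> G_D D" using qint_fraction_in_G_D[OF D_gt_0 denom_pos[OF e]] by simp
qed

lemma mult_subgroup_uprod: "mult_subgroup (uprod ` exponents) (G_D D)"
  unfolding mult_subgroup_def
proof (intro conjI ballI)
  show "uprod ` exponents \<subseteq> G_D D" using uprod_in_G_D by blast
  show "1 \<in> uprod ` exponents" using exponents_zero uprod_zero by (metis imageI)
next
  fix x y assume "x \<in> uprod ` exponents" "y \<in> uprod ` exponents"
  then obtain e e' where e: "e \<in> exponents" "e' \<in> exponents" "x = uprod e" "y = uprod e'" by blast
  show "x * y \<in> uprod ` exponents"
    unfolding e(3,4) uprod_add[OF e(1,2), symmetric] by (rule imageI, rule exponents_add[OF e(1,2)])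
next
  fix x assume "x \<in> uprod ` exponents"
  then obtain e where e: "e \<in> exponents" "x = uprod e" by blast
  show "inverse x \<in> uprod ` exponents"
    unfolding e(2) uprod_minus[symmetric] by (rule imageI, rule exponents_minus[OF e(1)])
qed

text \<open>Injectivity is independence up to sign; surjectivity is reduction to a primitive
  fraction followed by the descent.\<close>

lemma bij_betw_signed_uprod:
  "bij_betw (\<lambda>(\<epsilon>, f). \<epsilon> * f) ({1, -1} \<times> uprod ` exponents) (G_D D)"
proof (rule bij_betw_imageI)
  show "inj_on (\<lambda>(\<epsilon>, f). \<epsilon> * f) ({1, -1} \<times> uprod ` exponents)"
  proof (rule inj_onI, clarify)
    fix \<epsilon> \<epsilon>' :: complex and e e'
    assume e: "e \<in> exponents" "e' \<in> exponents" and "\<epsilon> \<in> {1, -1}" "\<epsilon>' \<in> {1, -1}"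
      and eq: "\<epsilon> * uprod e = \<epsilon>' * uprod e'"
    \<comment> \<open>Complex signs are replaced by integer ones, to which the independence result
      applies.\<close>
    then obtain \<delta> \<delta>' :: int where \<delta>: "\<delta> \<in> {1, -1}" "\<delta>' \<in> {1, -1}" "\<epsilon> = of_int \<delta>" "\<epsilon>' = of_int \<delta>'"
      by (metis insertE insertI1 insertI2 of_int_1 of_int_minus singletonD)
    then show "\<epsilon> = \<epsilon>' \<and> uprod e = uprod e'" using signed_uprod_inj[OF e \<delta>(1,2)] eq by simp
  qed
  have neg: "- z \<in> G_D D" if z: "z \<in> G_D D" for z
  proof -
    obtain a b c where "c > 0" "a^2 + D * b^2 = int c ^ 2" "gcd (gcd a b) (int c) = 1"
      "z = qint D a b / of_nat c" by (rule G_D_fraction[OF D_gt_0 z])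
    moreover have "qint D (-a) (-b) = - qint D a b" using qint_scale[of "-1" D a b] by simp
    ultimately show ?thesis using qint_fraction_in_G_D[OF D_gt_0, of c "-a" "-b"] by simp
  qed
  show "(\<lambda>(\<epsilon>, f). \<epsilon> * f) ` ({1, -1} \<times> uprod ` exponents) = G_D D"
  proof
    show "(\<lambda>(\<epsilon>, f). \<epsilon> * f) ` ({1, -1} \<times> uprod ` exponents) \<subseteq> G_D D"
      using neg uprod_in_G_D by auto
    show "G_D D \<subseteq> (\<lambda>(\<epsilon>, f). \<epsilon> * f) ` ({1, -1} \<times> uprod ` exponents)"
    proof
      fix z assume z: "z \<in> G_D D"
      obtain a b c where abc: "c > 0" "a^2 + D * b^2 = int c ^ 2" "gcd (gcd a b) (int c) = 1"
        "z = qint D a b / of_nat c" by (rule G_D_fraction[OF D_gt_0 z])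
      obtain \<epsilon> e where e: "\<epsilon> \<in> {1, -1}" "e \<in> exponents" "z = of_int \<epsilon> * uprod e"
        using primitive_solution_uprod[OF abc(1-3)] abc(4) by blast
      then have "(of_int \<epsilon>, uprod e) \<in> {1, -1} \<times> uprod ` exponents" by auto
      then show "z \<in> (\<lambda>(\<epsilon>, f). \<epsilon> * f) ` ({1, -1} \<times> uprod ` exponents)"
        unfolding e(3) by (rule rev_image_eqI) simp
    qed
  qed
qed

text \<open>Needed because \<open>free_abelian_mult\<close> indexes exponents by basis elements,
  whereas \<open>uprod\<close> indexes them by primes. Equal values would give two exponent vectors
  with one product.\<close>

lemma inj_on_u: "inj_on u P"
proof (rule inj_onI)
  fix p q assume pq: "p \<in> P" "q \<in> P" "u p = u q"
  then have "of_int 1 * uprod (\<lambda>x. if x = p then 1 else 0) = of_int 1 * uprod (\<lambda>x. if x = q then 1 else 0)"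
    by (simp add: uprod_single)
  from signed_uprod_inj(2)[OF exponents_single[OF pq(1)] exponents_single[OF pq(2)] _ _ this]
  have "(\<lambda>x. if x = p then 1 else 0 :: int) = (\<lambda>x. if x = q then 1 else 0)" by simp
  then show "p = q" by (metis zero_neq_one)
qed

text \<open>Converts exponents on basis elements into exponents on primes; the value 0 off
  \<open>P\<close> keeps the support inside \<open>P\<close>, as \<open>exponents\<close>
  demands.\<close>

definition pullback :: "(complex \<Rightarrow> int) \<Rightarrow> nat \<Rightarrow> int" where
  "pullback g p = (if p \<in> P then g (u p) else 0)"

lemma uprod_pullback:
  assumes "finite {b. g b \<noteq> 0}" "{b. g b \<noteq> 0} \<subseteq> u ` P"
  shows "pullback g \<in> exponents" "uprod (pullback g) = (\<Prod>b\<in>{b. g b \<noteq> 0}. b powi g b)"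
proof -
  let ?S = "{p. pullback g p \<noteq> 0}"
  have SP: "?S \<subseteq> P" and img: "{b. g b \<noteq> 0} = u ` ?S"
    using assms(2) by (auto simp: pullback_def split: if_splits)
  have inj: "inj_on u ?S" using inj_on_u SP by (rule inj_on_subset)
  then show "pullback g \<in> exponents"
    using assms(1) SP unfolding img exponents_def by (simp add: finite_image_iff)
  show "uprod (pullback g) = (\<Prod>b\<in>{b. g b \<noteq> 0}. b powi g b)"
    unfolding img prod.reindex[OF inj] uprod_def using SP
    by (intro prod.cong) (auto simp: pullback_def)
qed

lemma free_abelian_uprod: "free_abelian_mult (uprod ` exponents)"
  unfolding free_abelian_mult_def
proof (intro exI[of _ "u ` P"] conjI ballI)
  show "u ` P \<subseteq> uprod ` exponents"
  proof
    fix x assume "x \<in> u ` P"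
    then obtain p where p: "p \<in> P" "x = u p" by blast
    then have "x = uprod (\<lambda>q. if q = p then 1 else 0)" by (simp add: uprod_single)
    then show "x \<in> uprod ` exponents" using exponents_single[OF p(1)] by blast
  qed
next
  fix x assume "x \<in> uprod ` exponents"
  then obtain e where e: "e \<in> exponents" "x = uprod e" by blast
  define g where "g b = (if b \<in> u ` P then e (inv_into P u b) else 0)" for b
  have gu: "g (u p) = e p" if "p \<in> P" for p using that inj_on_u by (simp add: g_def)
  have supp: "{b. g b \<noteq> 0} \<subseteq> u ` {p. e p \<noteq> 0}"
    using inj_on_u by (auto simp: g_def split: if_splits)
  have fin: "finite {b. g b \<noteq> 0}" using supp e(1) by (auto simp: exponents_def intro: finite_subset)
  have sub: "{b. g b \<noteq> 0} \<subseteq> u ` P" by (auto simp: g_def split: if_splits)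
  have pb: "pullback g = e" using gu e(1) by (auto simp: pullback_def exponents_def fun_eq_iff)
  show "\<exists>!g. finite {b. g b \<noteq> 0} \<and> {b. g b \<noteq> 0} \<subseteq> u ` P \<and> x = (\<Prod>b\<in>{b. g b \<noteq> 0}. b powi g b)"
  proof (rule ex1I[of _ g])
    show "finite {b. g b \<noteq> 0} \<and> {b. g b \<noteq> 0} \<subseteq> u ` P \<and> x = (\<Prod>b\<in>{b. g b \<noteq> 0}. b powi g b)"
      using fin sub uprod_pullback(2)[OF fin sub] pb e(2) by simp
  next
    fix h assume h: "finite {b. h b \<noteq> 0} \<and> {b. h b \<noteq> 0} \<subseteq> u ` P \<and> x = (\<Prod>b\<in>{b. h b \<noteq> 0}. b powi h b)"
    then have "pullback h \<in> exponents" "of_int 1 * uprod (pullback h) = of_int 1 * uprod e"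
      using uprod_pullback[of h] e(2) by auto
    then have ph: "pullback h = e" using signed_uprod_inj(2)[OF _ e(1)] by blast
    show "h = g"
    proof
      fix b
      show "h b = g b"
      proof (cases "b \<in> u ` P")
        case True
        then obtain p where p: "p \<in> P" "b = u p" by blast
        then show ?thesis using fun_cong[OF ph, of p] gu[OF p(1)] by (simp add: pullback_def)
      next
        case False
        then show ?thesis using h sub by (metis (mono_tags, lifting) mem_Collect_eq subsetD)
      qed
    qed
  qed
qed

text \<open>Because denominators are exact, the fractions with denominator c are the signed products
  in which |e p| is the multiplicity of p in c. The leading factor 2 is the overall sign.\<close>

lemma card_primitive_solutions:
  assumes "c > 0" "prime_factors c \<subseteq> P"
  shows "card (primitive_solutions D c) = 2 * 2 ^ card (prime_factors c)"
proof -
  let ?A = "prime_factors c" and ?S = "{1, -1 :: int}"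
  let ?T = "{e. \<forall>p. \<bar>e p\<bar> = (if p \<in> ?A then int (multiplicity p c) else 0)}"
  let ?I = "primitive_solutions D c"
  have mult: "int (multiplicity p c) > 0" if "p \<in> ?A" for p
    using that by (simp add: prime_factors_multiplicity)
  have supp: "{p. e p \<noteq> 0} = ?A" if e: "e \<in> ?T" for e
  proof (rule Set.set_eqI)
    fix p
    have "\<bar>e p\<bar> = (if p \<in> ?A then int (multiplicity p c) else 0)" using e by blast
    then show "p \<in> {p. e p \<noteq> 0} \<longleftrightarrow> p \<in> ?A" using mult[of p] by (auto split: if_splits)
  qed
  have Texp: "e \<in> exponents" if "e \<in> ?T" for e
    unfolding exponents_def using supp[OF that] assms(2) by simp
  have Tden: "denom e = c" if e: "e \<in> ?T" for e
  proof -
    have "denom e = (\<Prod>p\<in>?A. p ^ multiplicity p c)"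
      unfolding denom_def supp[OF e] using e by (intro prod.cong) auto
    then show ?thesis using prod_prime_factors[of c] assms(1) by simp
  qed
  \<comment> \<open>Signed exponent vectors and solutions both inject into the complex numbers;
    equality of the images equates their numbers.\<close>
  have img: "(\<lambda>(\<epsilon>, e). of_int \<epsilon> * uprod e) ` (?S \<times> ?T) = (\<lambda>(a, b). qint D a b / of_nat c) ` ?I"
  proof (intro subset_antisym subsetI)
    fix z assume "z \<in> (\<lambda>(\<epsilon>, e). of_int \<epsilon> * uprod e) ` (?S \<times> ?T)"
    then obtain w where w: "z = (\<lambda>(\<epsilon>, e). of_int \<epsilon> * uprod e) w" "w \<in> ?S \<times> ?T" by (rule imageE)
    obtain \<epsilon> e where weq: "w = (\<epsilon>, e)" by (cases w)
    have z: "z = of_int \<epsilon> * uprod e" "\<epsilon> \<in> ?S" "e \<in> ?T" 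
      using w unfolding weq prod.case mem_Sigma_iff by blast+
    obtain a b where ab: "uprod e = qint D a b / of_nat (denom e)" "a^2 + D * b^2 = int (denom e) ^ 2"
      "gcd (gcd a b) (int (denom e)) = 1" by (rule uprod_fraction[OF Texp[OF z(3)]])
    have "z = qint D (\<epsilon> * a) (\<epsilon> * b) / of_nat c"
      unfolding z(1) ab(1) Tden[OF z(3)] by (simp flip: qint_scale)
    moreover have "(\<epsilon> * a, \<epsilon> * b) \<in> ?I"
      using ab(2,3) z(2) unfolding Tden[OF z(3)] by (auto simp: primitive_solutions_def)
    ultimately show "z \<in> (\<lambda>(a, b). qint D a b / of_nat c) ` ?I" by (intro rev_image_eqI) auto
  next
    fix z assume "z \<in> (\<lambda>(a, b). qint D a b / of_nat c) ` ?I"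
    then obtain w where w: "z = (\<lambda>(a, b). qint D a b / of_nat c) w" "w \<in> ?I" by (rule imageE)
    obtain a b where weq: "w = (a, b)" by (cases w)
    have z: "z = qint D a b / of_nat c" "a^2 + D * b^2 = int c ^ 2" "gcd (gcd a b) (int c) = 1"
      using w unfolding weq primitive_solutions_def by simp_all
    obtain \<epsilon> e where e: "\<epsilon> \<in> ?S" "e \<in> exponents" "z = of_int \<epsilon> * uprod e"
      using primitive_solution_uprod[OF assms(1) z(2,3)] z(1) by blast
    obtain a' b' where ab: "uprod e = qint D a' b' / of_nat (denom e)" "a'^2 + D * b'^2 = int (denom e) ^ 2"
      "gcd (gcd a' b') (int (denom e)) = 1" by (rule uprod_fraction[OF e(2)])
    have "qint D a b / of_nat c = qint D (\<epsilon> * a') (\<epsilon> * b') / of_nat (denom e)"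
      unfolding z(1)[symmetric] e(3) ab(1) by (simp flip: qint_scale)
    moreover have "gcd (gcd (\<epsilon> * a') (\<epsilon> * b')) (int (denom e)) = 1" using ab(3) e(1) by auto
    \<comment> \<open>Two reduced fractions for the same number have the same denominator.\<close>
    ultimately have c: "c = denom e"
      by (rule primitive_fraction_unique(3)[OF D_gt_0 assms(1) denom_pos[OF e(2)] z(3), rotated])
    have "\<bar>e p\<bar> = (if p \<in> ?A then int (multiplicity p c) else 0)" for p
    proof (cases "prime p")
      case True
      then have "int (multiplicity p c) = \<bar>e p\<bar>" unfolding c by (simp add: multiplicity_denom[OF e(2)])
      then show ?thesis using True by (auto simp: prime_factors_multiplicity)
    next
      case False
      then have "e p = 0" using e(2) prime_P by (auto simp: exponents_def)
      then show ?thesis using False by auto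
    qed
    then have "(\<epsilon>, e) \<in> ?S \<times> ?T" using e(1) by blast
    then show "z \<in> (\<lambda>(\<epsilon>, e). of_int \<epsilon> * uprod e) ` (?S \<times> ?T)" unfolding e(3) by (rule rev_image_eqI) simp
  qed
  have inj_signed: "inj_on (\<lambda>(\<epsilon>, e). of_int \<epsilon> * uprod e) (?S \<times> ?T)"
  proof (rule inj_onI, clarify)
    fix \<epsilon> \<epsilon>' e e' assume "\<epsilon> \<in> ?S" "\<epsilon>' \<in> ?S" "of_int \<epsilon> * uprod e = of_int \<epsilon>' * uprod e'"
      and T: "\<forall>p. \<bar>e p\<bar> = (if p \<in> ?A then int (multiplicity p c) else 0)"
        "\<forall>p. \<bar>e' p\<bar> = (if p \<in> ?A then int (multiplicity p c) else 0)"
    moreover have "e \<in> exponents" "e' \<in> exponents" by (rule Texp, rule CollectI, rule T)+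
    ultimately show "\<epsilon> = \<epsilon>' \<and> e = e'" using signed_uprod_inj[of e e' \<epsilon> \<epsilon>'] by blast
  qed
  have "inj_on (\<lambda>(a, b). qint D a b / of_nat c) ?I"
    using assms(1) by (auto intro!: inj_onI simp: qint_eq_iff[OF D_gt_0])
  then have "card ?I = card ((\<lambda>(a, b). qint D a b / of_nat c) ` ?I)" by (rule card_image[symmetric])
  also have "\<dots> = card (?S \<times> ?T)" unfolding img[symmetric] by (rule card_image[OF inj_signed])
  also have "\<dots> = 2 * card ?T" by (simp add: card_cartesian_product)
  also have "card ?T = 2 ^ card ?A" by (rule card_sign_choices) (use mult in auto)
  finally show ?thesis .
qed

end

theorem theorem1p1:
  fixes D :: int
  assumes "D > 1" and "squarefree D" and "(-D) mod 4 = 2 \<or> (-D) mod 4 = 3"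
    and "class_group_elem_2 D"
  shows "(\<exists>F. mult_subgroup F (G_D D) \<and> free_abelian_mult F \<and>
            bij_betw (\<lambda>(u, f). u * f) ({1, -1} \<times> F) (G_D D))
         \<and> (\<forall>c::nat. c > 1 \<longrightarrow>
              ((\<forall>p \<in> prime_factors c. p \<noteq> 2 \<and> Legendre (-D) (int p) = 1)
                 \<longrightarrow> card (normalized_solutions D c) = 2 ^ (card (prime_factors c) - 1))
            \<and> (\<not> (\<forall>p \<in> prime_factors c. p \<noteq> 2 \<and> Legendre (-D) (int p) = 1)
                 \<longrightarrow> normalized_solutions D c = {}))"
proof -
  \<comment> \<open>All admissible primes are taken at once, so that one exponent group serves all
    of G_D(Q) and every c.\<close>
  define P where "P = {p :: nat. prime p \<and> p \<noteq> 2 \<and> Legendre (-D) (int p) = 1}"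
  have "\<forall>p\<in>P. \<exists>s r. s^2 + D * r^2 = int p ^ 2 \<and> \<not> int p dvd s"
    using split_prime_square_rep assms(1,4) by (simp add: P_def)
  then obtain s r where sr: "\<And>p. p \<in> P \<Longrightarrow> s p ^ 2 + D * r p ^ 2 = int p ^ 2 \<and> \<not> int p dvd s p"
    by metis
  interpret split_prime_reps D P s r
  proof
    fix p assume "p \<in> P"
    then show "prime p" "odd p" by (auto simp: P_def primes_dvd_imp_eq[OF two_is_prime_nat])
  next
    fix a b c p
    assume "a^2 + D * b^2 = int c ^ 2" "gcd (gcd a b) (int c) = 1" "prime p" "p dvd c"
    then show "p \<in> P" using primitive_solution_prime_split[OF assms(2,3), of a b c p] by (simp add: P_def)
  qed (use assms(1,2) sr in auto)
  have "card (normalized_solutions D c) = 2 ^ (card (prime_factors c) - 1)"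
    if c: "c > 1" and "\<forall>p \<in> prime_factors c. p \<noteq> 2 \<and> Legendre (-D) (int p) = 1" for c
  proof -
    have "prime_factors c \<subseteq> P" using that(2) by (auto simp: P_def)
    then have "4 * card (normalized_solutions D c) = 2 * 2 ^ card (prime_factors c)"
      using card_primitive_solutions[of c] card_primitive_solutions_normalized[OF assms(2) c] c by simp
    \<comment> \<open>Positivity matters: only then is the truncated k - 1 a genuine predecessor,
      and 4 N = 2 * 2^k gives N = 2^(k-1).\<close>
    moreover have "card (prime_factors c) > 0"
      using c prime_factor_nat[of c] by (auto simp: card_gt_0_iff prime_factors_dvd)
    then obtain k where "card (prime_factors c) = Suc k" by (metis gr0_implies_Suc)
    ultimately show ?thesis by simp
  qed
  moreover have "normalized_solutions D c = {}"
    if c: "c > 1" and "\<not> (\<forall>p \<in> prime_factors c. p \<noteq> 2 \<and> Legendre (-D) (int p) = 1)" for c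
  proof (rule ccontr)
    assume "normalized_solutions D c \<noteq> {}"
    then obtain a b where "(a, b) \<in> normalized_solutions D c" by auto
    then have "int a ^ 2 + D * int b ^ 2 = int c ^ 2" "gcd (gcd (int a) (int b)) (int c) = 1"
      unfolding normalized_iff_primitive primitive_solutions_def by auto
    then show False
      using that(2) primitive_solution_prime_split[OF assms(2,3)] by (meson in_prime_factors_iff)
  qed
  ultimately show ?thesis
    using mult_subgroup_uprod free_abelian_uprod bij_betw_signed_uprod by blast
qed

end
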